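(* Let $a,b,c,d,e,f\in\mathbb{C}$ be such that either $c\neq0$ or $b=c=0$. Then, as maps $\mathbb{C}^{\mathbb{N}}\to\mathbb{C}^{\mathbb{N}}$, \[ \mathscr{Y}_{e,0,-d,f}\circ\mathscr{Y}_{a,b,c,d}=\mathscr{Y}_{a+e,b,c,f}. \]
   Context: For $n\ge k\ge1$, the partial Bell polynomial $B_{n,k}\in\mathbb{Q}[X_1,X_2,\dots]$ is defined by $\frac1{k!}\big(\sum_{j\ge1}X_j\frac{z^j}{j!}\big)^k=\sum_{n\ge k}B_{n,k}(X)\frac{z^n}{n!}$. For a sequence $x=(x_n)_{n\in\mathbb{N}}\in\mathbb{C}^{\mathbb{N}}$ write $!x=(n!\,x_n)_{n\in\mathbb{N}}$. For $a,b,c,d\in\mathbb{C}$, the Bell transformation $\mathscr{Y}_{a,b,c,d}:\mathbb{C}^{\mathbb{N}}\to\mathbb{C}^{\mathbb{N}}$ sends $x$ to $y$ with \[ y_n=\frac1{n!}\sum_{k=1}^n\Big[\prod_{j=1}^{k-1}(an+bk+cj+d)\Big]B_{n,k}(!x)\qquad(n\ge1), \] where an empty product equals $1$. *)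

theory Defs
  imports Complex_Main "HOL-Computational_Algebra.Formal_Power_Series"
begin

(* Sequences are indexed by the positive integers. They are represented as total functions
   on nat whose value at 0 is never read; bell_transform always returns 0 at index 0, so
   equality of two (compositions of) Bell transformations as functions is exactly equality
   of all entries with index n >= 1, for all input sequences. *)

definition exp_gf :: "(nat \<Rightarrow> 'a::field_char_0) \<Rightarrow> 'a fps" where
  "exp_gf x = Abs_fps (\<lambda>j. if j = 0 then 0 else x j / fact j)"

(* The value at X = x of the partial Bell polynomial B_{n,k}, read off from its defining
   generating function; see partial_bell_gf. *)
definition partial_bell :: "nat \<Rightarrow> nat \<Rightarrow> (nat \<Rightarrow> 'a::field_char_0) \<Rightarrow> 'a" where
  "partial_bell n k x = fact n * fps_nth (fps_const (1 / fact k) * exp_gf x ^ k) n"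

lemma partial_bell_gf:
  "fps_const (1 / fact k) * exp_gf x ^ k = Abs_fps (\<lambda>n. partial_bell n k x / fact n)"
  by (rule fps_ext) (simp add: partial_bell_def)

lemma partial_bell_eq_0:
  assumes "n < k"
  shows "partial_bell n k x = 0"
proof -
  have "fps_nth (exp_gf x) 0 = 0"
    by (simp add: exp_gf_def)
  then have "fps_nth (exp_gf x ^ k) n = 0"
    using assms by (simp add: startsby_zero_power_prefix)
  then show ?thesis
    by (simp add: partial_bell_def)
qed

(* The sequence !x. *)
definition fact_scale :: "(nat \<Rightarrow> complex) \<Rightarrow> nat \<Rightarrow> complex" where
  "fact_scale x = (\<lambda>n. fact n * x n)"

definition bell_transform ::
    "complex \<Rightarrow> complex \<Rightarrow> complex \<Rightarrow> complex \<Rightarrow> (nat \<Rightarrow> complex) \<Rightarrow> nat \<Rightarrow> complex" where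
  "bell_transform a b c d x = (\<lambda>n. 1 / fact n *
     (\<Sum>k=1..n. (\<Prod>j=1..k-1. a * of_nat n + b * of_nat k + c * of_nat j + d)
                 * partial_bell n k (fact_scale x)))"

end

theory Submission
  imports Defs
begin

text \<open>
  Every Bell transform has the form $y_n = [z^n] (e^{dG(z)} - 1)/d$ for a power series $G$ that
  depends on $a$, $b$, $c$ and $x$ but not on $d$. For $a = b = 0$ this is the binomial series,
  with $G = L_c(X)$, where $X = \sum x_n z^n$ and $L_c(z) = -\ln(1 - cz)/c$. By Lagrange inversion,
  replacing $g$ by $g \circ w$, where $w$ is the compositional inverse of $z e^{-bg(z)}$, turns the
  $n$-th coefficient of $(e^{sg} - 1)/s$ into the one for $s + bn$; doing this for $b$ before
  substituting $X$, and for $a$ afterwards, produces the terms $bk$ and $an$. Now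
  $Y = (e^{dG} - 1)/d$ gives $L_{-d}(Y) = G$, so the outer transform, in which the $G$ of $y$ is
  just $L_{-d}(Y)$, sees the same series $G$ again, and its parameter is $en + f$.
\<close>

unbundle fps_syntax

text \<open>Since \<open>v ^ i\<close> starts at degree i or later, each inner sum can be extended
  to one range i \<le> N independent of the degree, and the sums can be swapped.\<close>

lemma fps_mult_compose_truncate:
  fixes C v h :: "'a::idom fps"
  assumes v0: "v $ 0 = 0"
  shows "((C oo v) * h) $ N = (\<Sum>i\<le>N. C $ i * (v ^ i * h) $ N)"
proof -
  have "((C oo v) * h) $ N = (\<Sum>m\<le>N. (\<Sum>i\<le>N. C $ i * (v ^ i) $ m) * h $ (N - m))"
  proof -
    have "(C oo v) $ m = (\<Sum>i\<le>N. C $ i * (v ^ i) $ m)" if "m \<le> N" for m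
      unfolding fps_compose_nth using that v0
      by (intro sum.mono_neutral_left) (auto simp: startsby_zero_power_prefix)
    then show ?thesis
      by (simp add: fps_mult_nth atMost_atLeast0)
  qed
  also have "\<dots> = (\<Sum>i\<le>N. \<Sum>m\<le>N. C $ i * ((v ^ i) $ m * h $ (N - m)))"
    by (subst sum.swap) (simp add: sum_distrib_right mult.assoc)
  also have "\<dots> = (\<Sum>i\<le>N. C $ i * (v ^ i * h) $ N)"
    by (simp add: fps_mult_nth sum_distrib_left atMost_atLeast0)
  finally show ?thesis .
qed

text \<open>
  With $v = z/\phi$, this is the residue of $v'/v^{m+1}$, stated without negative powers.
\<close>

lemma lagrange_residue:
  fixes \<phi> :: "'a::field_char_0 fps"
  assumes \<phi>0: "\<phi> $ 0 \<noteq> 0"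
  shows "(fps_deriv (fps_X * inverse \<phi>) * \<phi> ^ Suc m) $ m = (if m = 0 then 1 else 0)"
proof (cases m)
  case 0
  then show ?thesis
    using \<phi>0 by (simp add: fps_mult_nth)
next
  case (Suc k)
  have inv: "inverse \<phi> * \<phi> = 1"
    using \<phi>0 by (rule inverse_mult_eq_1)
  have "fps_deriv (fps_X * inverse \<phi>) * \<phi> ^ Suc m
      = \<phi> ^ m * (inverse \<phi> * \<phi>)
        - fps_X * fps_deriv \<phi> * \<phi> ^ k * (inverse \<phi> * \<phi>) * (inverse \<phi> * \<phi>)"
    using \<phi>0 by (simp add: fps_inverse_deriv Suc power2_eq_square algebra_simps)
  also have "\<dots> = \<phi> ^ m - fps_X * (fps_deriv \<phi> * \<phi> ^ k)"
    by (simp add: inv mult.assoc)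
  finally have *: "fps_deriv (fps_X * inverse \<phi>) * \<phi> ^ Suc m
      = \<phi> ^ m - fps_X * (fps_deriv \<phi> * \<phi> ^ k)" .
  \<comment> \<open>As m \<phi>' \<phi>^k is the derivative of \<phi>^m, its coefficient at k = m -
    1 is m [z^m] \<phi>^m; hence the two terms in \<open>*\<close> cancel at degree m.\<close>
  have "of_nat m * (fps_deriv \<phi> * \<phi> ^ k) $ k = fps_deriv (\<phi> ^ m) $ k"
    by (simp only: fps_deriv_power) (simp add: Suc mult.assoc)
  also have "\<dots> = of_nat m * (\<phi> ^ m) $ m"
    by (simp only: fps_deriv_nth Suc Suc_eq_plus1)
  finally have "(fps_deriv \<phi> * \<phi> ^ k) $ k = (\<phi> ^ m) $ m"
    using Suc by (simp del: of_nat_Suc)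
  then show ?thesis
    unfolding * by (simp add: Suc)
qed

text \<open>Put v = z/\<phi> and F = C(v), so F' = C'(v) v'. Expanding C'(v) in powers of v, the
  residue computation kills every term except i = n.\<close>

theorem fps_lagrange_inversion:
  fixes F \<phi> :: "'a::field_char_0 fps"
  assumes \<phi>0: "\<phi> $ 0 \<noteq> 0"
  shows "of_nat (Suc n) * (F oo fps_inv (fps_X * inverse \<phi>)) $ Suc n
    = (fps_deriv F * \<phi> ^ Suc n) $ n"
proof -
  define v where "v = fps_X * inverse \<phi>"
  define C where "C = F oo fps_inv v"
  have v0: "v $ 0 = 0" and v1: "v $ 1 \<noteq> 0"
    using \<phi>0 by (simp_all add: v_def)
  have "F = C oo v"
    using fps_inv[OF v0 v1] by (simp add: C_def v0 fps_inv_def flip: fps_compose_assoc)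
  then have "(fps_deriv F * \<phi> ^ Suc n) $ n
      = ((fps_deriv C oo v) * (fps_deriv v * \<phi> ^ Suc n)) $ n"
    using v0 by (simp add: fps_compose_deriv mult.assoc)
  also have "\<dots> = (\<Sum>i\<le>n. fps_deriv C $ i * (v ^ i * (fps_deriv v * \<phi> ^ Suc n)) $ n)"
    using v0 by (rule fps_mult_compose_truncate)
  also have "\<dots> = (\<Sum>i\<le>n. fps_deriv C $ i * (if i = n then 1 else 0))"
  proof (intro sum.cong refl arg_cong2[where f = "(*)"])
    fix i assume "i \<in> {..n}"
    then have i: "i \<le> n" by simp
    \<comment> \<open>The factor v^i absorbs \<phi>^i and leaves z^i, which lowers the coefficient
      index from n to n - i.\<close>
    have "v * \<phi> = fps_X"
      using \<phi>0 by (simp add: v_def mult.assoc inverse_mult_eq_1)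
    then have "v ^ i * \<phi> ^ i = fps_X ^ i"
      by (metis power_mult_distrib)
    moreover have "\<phi> ^ Suc n = \<phi> ^ i * \<phi> ^ Suc (n - i)"
      using i by (simp flip: power_add)
    ultimately have "v ^ i * (fps_deriv v * \<phi> ^ Suc n)
        = fps_X ^ i * (fps_deriv v * \<phi> ^ Suc (n - i))"
      by (metis mult.assoc mult.left_commute)
    then have "(v ^ i * (fps_deriv v * \<phi> ^ Suc n)) $ n
        = (fps_deriv v * \<phi> ^ Suc (n - i)) $ (n - i)"
      using i by (simp only: fps_X_power_mult_nth) simp
    then show "(v ^ i * (fps_deriv v * \<phi> ^ Suc n)) $ n = (if i = n then 1 else 0)"
      using i unfolding v_def lagrange_residue[OF \<phi>0] by auto
  qed
  also have "\<dots> = fps_deriv C $ n"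
    by (simp only: mult_delta_right sum.delta) simp
  finally show ?thesis
    by (simp add: C_def v_def)
qed

text \<open>
  The series $(e^{sz} - 1)/s$ and $-\ln(1 - cz)/c$, extended to $s = 0$ and $c = 0$ by $z$
  (recall that \<open>0 ^ 0 = 1\<close>).
\<close>

definition exp_quot :: "'a::field_char_0 \<Rightarrow> 'a fps" where
  "exp_quot s = Abs_fps (\<lambda>m. if m = 0 then 0 else s ^ (m - 1) / fact m)"

definition log_quot :: "'a::field_char_0 \<Rightarrow> 'a fps" where
  "log_quot c = Abs_fps (\<lambda>m. if m = 0 then 0 else c ^ (m - 1) / of_nat m)"

lemma exp_quot_nth_0 [simp]: "exp_quot s $ 0 = 0"
  by (simp add: exp_quot_def)

lemma log_quot_nth_0 [simp]: "log_quot c $ 0 = 0"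
  by (simp add: log_quot_def)

lemma fps_deriv_exp_quot: "fps_deriv (exp_quot s) = fps_exp s"
  by (rule fps_ext) (simp add: exp_quot_def del: of_nat_Suc)

lemma fps_deriv_log_quot: "fps_deriv (log_quot c) * (1 - fps_const c * fps_X) = 1"
proof (rule fps_ext)
  fix n
  show "(fps_deriv (log_quot c) * (1 - fps_const c * fps_X)) $ n = 1 $ n"
    by (cases n) (simp_all add: log_quot_def right_diff_distrib del: of_nat_Suc flip: mult.assoc)
qed

lemma fps_exp_eq_exp_quot: "fps_exp s = 1 + fps_const s * exp_quot s"
proof (rule fps_ext)
  fix n
  show "fps_exp s $ n = (1 + fps_const s * exp_quot s) $ n"
    by (cases n) (simp_all add: exp_quot_def algebra_simps)
qed

text \<open>Both sides vanish at 0, so it suffices to compare derivatives; this treats d = 0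
  uniformly.\<close>

lemma log_quot_compose_exp_quot: "log_quot (- d) oo exp_quot d = fps_X"
proof -
  have "1 = (fps_deriv (log_quot (- d)) * (1 - fps_const (- d) * fps_X)) oo exp_quot d"
    by (simp add: fps_deriv_log_quot)
  also have "\<dots> = (fps_deriv (log_quot (- d)) oo exp_quot d) * (1 + fps_const d * exp_quot d)"
    by (simp add: fps_compose_mult_distrib fps_compose_add_distrib flip: fps_const_neg)
  also have "\<dots> = fps_deriv (log_quot (- d) oo exp_quot d)"
    by (simp add: fps_compose_deriv fps_deriv_exp_quot flip: fps_exp_eq_exp_quot)
  finally have "fps_deriv (log_quot (- d) oo exp_quot d) = fps_deriv fps_X"
    by simp
  then show ?thesis
    unfolding fps_deriv_eq_iff by simp
qed

text \<open>For nonzero t and c this is the binomial series of ((1 - cz)^(-t/c) - 1)/t. Its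
  derivative D satisfies (1 - cz) D' = (t + c) D, a first-order recurrence for the coefficients that
  never divides by t or c.\<close>

lemma exp_quot_compose_log_quot_nth_Suc:
  "(exp_quot t oo log_quot c) $ Suc n = (\<Prod>j=1..n. t + c * of_nat j) / fact (Suc n)"
proof -
  define D where "D = fps_deriv (exp_quot t oo log_quot c)"
  define L where "L = fps_deriv (log_quot c)"
  define e where "e = fps_exp t oo log_quot c"
  have D: "D = e * L"
    by (simp add: D_def L_def e_def fps_compose_deriv fps_deriv_exp_quot)
  have L: "L * (1 - fps_const c * fps_X) = 1"
    by (simp add: L_def fps_deriv_log_quot)
  have "D * (1 - fps_const c * fps_X) = e"
    by (simp add: D mult.assoc L)
  then have "fps_deriv (D * (1 - fps_const c * fps_X)) = fps_deriv e"
    by simp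
  also have "\<dots> = fps_const t * D"
    by (simp add: D, simp add: e_def L_def fps_compose_deriv fps_compose_mult_distrib mult.assoc)
  finally have *: "fps_deriv D - fps_const c * (fps_X * fps_deriv D) = fps_const (t + c) * D"
    by (simp add: algebra_simps flip: fps_const_add)
  have rec: "of_nat (Suc n) * D $ Suc n = (t + c * of_nat (Suc n)) * D $ n" for n
    using arg_cong[OF *, of "\<lambda>f. f $ n"] by (cases n) (simp_all add: algebra_simps)
  have "D $ n = (\<Prod>j=1..n. t + c * of_nat j) / fact n"
  proof (induction n)
    case 0
    have "D $ 0 = 1"
      by (simp add: D e_def L_def log_quot_def)
    then show ?case by simp
  next
    case (Suc n)
    have "D $ Suc n = (t + c * of_nat (Suc n)) * D $ n / of_nat (Suc n)"
      using rec[of n] by (simp add: field_simps del: of_nat_Suc)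
    then show ?case
      by (simp add: Suc mult.commute del: of_nat_Suc)
  qed
  then show ?thesis
    by (simp add: D_def field_simps del: of_nat_Suc)
qed

text \<open>For g without constant term, the result h satisfies h(z) = g(z e^(b h(z))).\<close>

definition lagrange_transform :: "'a::field_char_0 \<Rightarrow> 'a fps \<Rightarrow> 'a fps" where
  "lagrange_transform b g = g oo fps_inv (fps_X * inverse (fps_exp b oo g))"

lemma lagrange_transform_nth_0 [simp]: "lagrange_transform b g $ 0 = g $ 0"
  by (simp add: lagrange_transform_def)

text \<open>Lagrange inversion multiplies the derivative e^(sg) g' by e^(nbg), which amounts to
  replacing s by s + bn.\<close>

lemma exp_quot_compose_lagrange_transform:
  assumes g0: "g $ 0 = 0"
  shows "(exp_quot s oo lagrange_transform b g) $ n = (exp_quot (s + b * of_nat n) oo g) $ n"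
proof (cases n)
  case 0
  then show ?thesis by simp
next
  case (Suc m)
  define \<phi> where "\<phi> = fps_exp b oo g"
  have \<phi>0: "\<phi> $ 0 \<noteq> 0"
    by (simp add: \<phi>_def)
  have w0: "fps_inv (fps_X * inverse \<phi>) $ 0 = 0"
    by (simp add: fps_inv_def)
  have "of_nat n * (exp_quot s oo lagrange_transform b g) $ n
      = of_nat (Suc m) * ((exp_quot s oo g) oo fps_inv (fps_X * inverse \<phi>)) $ Suc m"
    by (simp add: Suc lagrange_transform_def \<phi>_def[symmetric] fps_compose_assoc g0 w0)
  also have "\<dots> = (fps_deriv (exp_quot s oo g) * \<phi> ^ n) $ m"
    using fps_lagrange_inversion[OF \<phi>0] by (simp add: Suc)
  also have "fps_deriv (exp_quot s oo g) * \<phi> ^ n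
      = (fps_exp s * fps_exp (of_nat n * b) oo g) * fps_deriv g"
    by (simp add: \<phi>_def fps_compose_deriv g0 fps_deriv_exp_quot fps_compose_power
        fps_exp_power_mult fps_compose_mult_distrib mult_ac)
  also have "\<dots> = fps_deriv (exp_quot (s + b * of_nat n) oo g)"
    by (simp add: fps_compose_deriv g0 fps_deriv_exp_quot fps_exp_add_mult mult.commute)
  finally show ?thesis
    by (simp add: Suc del: of_nat_Suc)
qed

lemma bell_transform_nth:
  "bell_transform a b c d x n = (\<Sum>k=1..n. (\<Prod>j=1..k-1. a * of_nat n + b * of_nat k + c * of_nat j + d)
     / fact k * (exp_gf (fact_scale x) ^ k) $ n)"
  by (simp add: bell_transform_def partial_bell_def sum_distrib_left)

text \<open>The outer Lagrange transform is read at degree n and adds an to d; the inner one is read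
  at degree k, as the coefficient of X^k, and adds bk.\<close>

lemma bell_transform_conv_exp_quot:
  defines "X \<equiv> \<lambda>x. exp_gf (fact_scale x)"
  defines "G \<equiv> \<lambda>a b c x. lagrange_transform a (lagrange_transform b (log_quot c) oo X x)"
  shows "bell_transform a b c d x n = (exp_quot d oo G a b c x) $ n"
proof -
  define s where "s = d + a * of_nat n"
  have X0: "X x $ 0 = 0"
    by (simp add: X_def exp_gf_def)
  have "(exp_quot d oo G a b c x) $ n = ((exp_quot s oo lagrange_transform b (log_quot c)) oo X x) $ n"
    unfolding G_def s_def
    by (simp add: exp_quot_compose_lagrange_transform X0 fps_compose_assoc)
  also have "\<dots> = (\<Sum>k=1..n. (exp_quot s oo lagrange_transform b (log_quot c)) $ k * (X x ^ k) $ n)"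
    by (simp add: fps_compose_nth[of _ "X x"] sum.atLeast_Suc_atMost)
  also have "\<dots> = bell_transform a b c d x n"
    unfolding bell_transform_nth
  proof (intro sum.cong refl arg_cong2[where f = "(*)"])
    fix k assume "k \<in> {1..n}"
    then obtain m where m: "k = Suc m"
      by (cases k) auto
    show "(exp_quot s oo lagrange_transform b (log_quot c)) $ k
        = (\<Prod>j=1..k-1. a * of_nat n + b * of_nat k + c * of_nat j + d) / fact k"
      unfolding exp_quot_compose_lagrange_transform[OF log_quot_nth_0] m
        exp_quot_compose_log_quot_nth_Suc
      by (simp add: s_def algebra_simps)
  qed (simp add: X_def)
  finally show ?thesis ..
qed

theorem theorem3p1:
  fixes a b c d e f :: complex
  assumes "c \<noteq> 0 \<or> (b = 0 \<and> c = 0)"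
  shows "bell_transform e 0 (-d) f \<circ> bell_transform a b c d = bell_transform (a + e) b c f"
proof (intro ext)
  fix x n
  define G where "G = lagrange_transform a (lagrange_transform b (log_quot c) oo exp_gf (fact_scale x))"
  define y where "y = bell_transform a b c d x"
  define Y where "Y = exp_gf (fact_scale y)"
  have G0: "G $ 0 = 0"
    by (simp add: G_def)
  have y: "y n = (exp_quot d oo G) $ n" for n
    by (simp add: y_def G_def bell_transform_conv_exp_quot)
  have Y: "Y = exp_quot d oo G"
    by (rule fps_ext) (simp add: Y_def exp_gf_def fact_scale_def y)
  \<comment> \<open>At a fixed index n, the term e'n is a constant and can move into the last
    parameter.\<close>
  have shift: "bell_transform (a' + e') b' c' f' z n = bell_transform a' b' c' (e' * of_nat n + f') z n"
    for a' e' b' c' f' z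
    by (simp add: bell_transform_nth algebra_simps)
  have lt0: "lagrange_transform 0 g = g" for g :: "complex fps"
    using fps_inv_right[of "fps_X :: complex fps"]
    by (simp add: lagrange_transform_def fps_X_fps_compose_startby0 fps_inv_def)
  \<comment> \<open>Once en is shifted into f, both Lagrange transforms have parameter 0 and are
    trivial.\<close>
  have "bell_transform e 0 (- d) f y n = (exp_quot (e * of_nat n + f) oo (log_quot (- d) oo Y)) $ n"
    using shift[of 0 e 0 "- d" f y]
    by (simp add: bell_transform_conv_exp_quot lt0 Y_def)
  also have "log_quot (- d) oo Y = G"
    by (simp add: Y fps_compose_assoc G0 log_quot_compose_exp_quot)
  also have "(exp_quot (e * of_nat n + f) oo G) $ n = bell_transform (a + e) b c f x n"
    by (simp only: shift G_def flip: bell_transform_conv_exp_quot)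
  finally show "(bell_transform e 0 (- d) f \<circ> bell_transform a b c d) x n = bell_transform (a + e) b c f x n"
    by (simp add: y_def)
qed

end
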